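(* Let $N\ge 2$, $0<\beta\le 1$, $h_0>0$, $\delta>0$, and let $\Omega\subsetneq\mathbb{R}^N$ be an open set satisfying a uniform exterior $\beta$-funnel condition with height $h_0$ and opening $\delta$. Then, for \[ r_0=\sqrt{h_0^2+\left(\frac{h_0}{\delta}\right)^{\frac{2}{\beta}}}\qquad \text{and}\qquad t=(N-1)\,\left(\frac{1}{\beta}-1\right), \] we have \[ \theta^*_{\Omega,r_0}(t)\ge c_{N,\beta}\,\min\left\{\left(\frac{h_0^{1-\beta}}{\delta}\right)^{\frac{1}{\beta}\,\frac{N-1}{\beta}},\,\left(\frac{\delta}{h_0^{1-\beta}}\right)^{\frac{1}{\beta}}\right\}, \] for an explicit constant $c_{N,\beta}>0$ depending only on $N$ and $\beta$.
   Context: $B_r(x)$ is the open Euclidean ball in $\mathbb{R}^N$ of center $x$ and radius $r$; $|\cdot|$ is Lebesgue measure (or the Euclidean norm, for vectors). Funnel: for $0<\beta\le 1$, $\delta,h>0$ and $\omega\in\mathbb{S}^{N-1}$, the $\beta$-funnel of axis $\omega$ with height $h$ and opening $\delta$ is \[ \mathscr{F}_\beta(\omega;\delta,h)=\{x\in\mathbb{R}^N : \delta\,|x-\langle x,\omega\rangle\,\omega|^\beta\le \langle x,\omega\rangle\le h \}. \] An open set $\Omega\subsetneq\mathbb{R}^N$ satisfies a uniform exterior $\beta$-funnel condition with height $h_0$ and opening $\delta$ if for every $x\in\partial\Omega$ there exists $\omega_x\in\mathbb{S}^{N-1}$ such that $x+\mathscr{F}_\beta(\omega_x;\delta,h_0)\subseteq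 \mathbb{R}^N\setminus\Omega$. Measure density index: for $r_0>0$, $t\ge 0$, \[ \theta^*_{\Omega,r_0}(t)=\inf\left\{\left(\frac{r_0}{r}\right)^t\,\frac{|B_r(x)\setminus \Omega|}{|B_r(x)|} : x\in \partial \Omega,\ 0 < r \le r_0\right\}. \] *)

theory Defs
  imports "HOL-Analysis.Analysis"
begin

definition beta_funnel ::
    "real \<Rightarrow> 'a::euclidean_space \<Rightarrow> real \<Rightarrow> real \<Rightarrow> 'a set" where
  "beta_funnel \<beta> \<omega> \<delta> h =
     {x. \<delta> * norm (x - (x \<bullet> \<omega>) *\<^sub>R \<omega>) powr \<beta> \<le> x \<bullet> \<omega> \<and> x \<bullet> \<omega> \<le> h}"

definition uniform_exterior_funnel ::
    "real \<Rightarrow> real \<Rightarrow> real \<Rightarrow> 'a::euclidean_space set \<Rightarrow> bool" where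
  "uniform_exterior_funnel \<beta> h\<^sub>0 \<delta> \<Omega> \<longleftrightarrow>
     (\<forall>x\<in>frontier \<Omega>. \<exists>\<omega>\<in>sphere 0 1. (+) x ` beta_funnel \<beta> \<omega> \<delta> h\<^sub>0 \<subseteq> - \<Omega>)"

text \<open>The infimum is taken in the extended reals, so that it is \<open>\<infinity>\<close> when the boundary is empty
  (among open proper subsets this happens only for the empty set). On \<^typ>\<open>real\<close>, the infimum of
  the empty set would be an unspecified number.\<close>

definition density_index :: "'a::euclidean_space set \<Rightarrow> real \<Rightarrow> real \<Rightarrow> ereal" where
  "density_index \<Omega> r\<^sub>0 t =
     Inf {ereal ((r\<^sub>0 / r) powr t *
            (measure lebesgue (ball x r - \<Omega>) / measure lebesgue (ball x r))) | x r.
          x \<in> frontier \<Omega> \<and> 0 < r \<and> r \<le> r\<^sub>0}"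

end

theory Submission
  imports Defs
begin

text \<open>
  Fix a boundary point \<open>x\<close> and write \<open>N\<close> for the dimension. The exterior funnel of height \<open>h\<close> at
  \<open>x\<close> has largest radius \<open>\<kappa> * h\<close> with \<open>\<kappa> = (h powr (1 - \<beta>) / \<delta>) powr (1 / \<beta>)\<close>, and
  \<open>r\<^sub>0 = h * sqrt (1 + \<kappa>\<^sup>2)\<close> is the distance from its apex to its rim. For \<open>r = s * r\<^sub>0\<close> with
  \<open>0 < s \<le> 1\<close>, the part of the funnel between the heights \<open>s * h / 2\<close> and \<open>s * h\<close> contains a cylinder
  of radius \<open>\<kappa> * h * (s / 2) powr (1 / \<beta>)\<close> that lies in the ball of radius \<open>r\<close>
  (\<open>cylinder_subset_funnel\<close>). Its volume is, up to a constant depending on \<open>N\<close> and \<open>\<beta>\<close>,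
  \<open>s * h * (\<kappa> * h * s powr (1 / \<beta>)) ^ (N - 1)\<close>.

  Dividing by the volume of the ball, which is proportional to \<open>(s * h * sqrt (1 + \<kappa>\<^sup>2)) ^ N\<close>, leaves
  \<open>s powr t * \<kappa> ^ (N - 1) / sqrt (1 + \<kappa>\<^sup>2) ^ N\<close> with \<open>t = (N - 1) * (1 / \<beta> - 1)\<close>. The weight
  \<open>(r\<^sub>0 / r) powr t\<close> removes the dependence on \<open>s\<close> (\<open>weighted_density_ge\<close>). The remaining
  function of \<open>\<kappa>\<close> is bounded below by a multiple of \<open>min (\<kappa> powr ((N - 1) / \<beta>)) (1 / \<kappa>)\<close>
  (\<open>min_profile_le\<close>), and this minimum is the one in the theorem.

  The axis of the funnel is arbitrary, so the volume of the cylinder is estimated by rotating a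
  coordinate box (\<open>measure_cylinder_ge\<close>). That rotations preserve volume follows from Vitali's
  covering theorem (\<open>emeasure_orthogonal_image_open\<close>).
\<close>

section \<open>Volumes of cylinders in arbitrary directions\<close>

text \<open>An orthogonal map sends balls to balls of the same radius. By Vitali's theorem an open set is,
  up to a null set, a countable disjoint union of balls, and a linear map keeps null sets null.\<close>

lemma emeasure_orthogonal_image_open:
  fixes f :: "'a::euclidean_space \<Rightarrow> 'a"
  assumes f: "orthogonal_transformation f" and S: "open S"
  shows "emeasure lebesgue (f ` S) = emeasure lebesgue S"
proof -
  define K where "K = {(x, r). 0 < r \<and> ball x r \<subseteq> S}"
  define B where "B = (\<lambda>i::'a \<times> real. ball (fst i) (snd i))"
  have fine: "\<exists>i. i \<in> K \<and> x \<in> ball (fst i) (snd i) \<and> snd i < d" if x: "x \<in> S" and d: "0 < d" for x d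
  proof -
    obtain e where e: "e > 0" "ball x e \<subseteq> S"
      using S x open_contains_ball by blast
    have "ball x (min e (d / 2)) \<subseteq> S"
      using e(2) by auto
    then have "(x, min e (d / 2)) \<in> K"
      using e d by (simp add: K_def)
    then show ?thesis
      using e d by (intro exI[of _ "(x, min e (d / 2))"]) auto
  qed
  obtain C where C: "countable C" "C \<subseteq> K" "pairwise (\<lambda>i j. disjnt (B i) (B j)) C"
      and null: "negligible (S - (\<Union>i\<in>C. B i))"
    by (rule Vitali_covering_theorem_balls[of S K fst snd])
       (erule (1) fine, rule that[unfolded B_def])
  let ?U = "\<Union>i\<in>C. B i"
  have "?U \<subseteq> S"
    using C(2) by (force simp: K_def B_def)
  then have S_eq: "S = ?U \<union> (S - ?U)"
    by blast
  have disj: "disjoint_family_on B C"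
    using C(3) by (auto simp: disjoint_family_on_def pairwise_def disjnt_def)
  have disj': "disjoint_family_on (\<lambda>i. f ` B i) C"
    using disj orthogonal_transformation_inj[OF f]
    by (simp add: disjoint_family_on_def flip: image_Int)
  have ball_img: "f ` B i = ball (f (fst i)) (snd i)" for i
    unfolding B_def using image_orthogonal_transformation_ball[OF f] .
  have f_U: "f ` ?U = (\<Union>i\<in>C. f ` B i)"
    by (rule image_UN)
  have null': "negligible (f ` (S - ?U))"
    using null orthogonal_transformation_linear[OF f]
    by (intro negligible_differentiable_image_negligible linear_imp_differentiable_on) auto
  have meas: "?U \<in> sets lebesgue" "f ` ?U \<in> sets lebesgue"
    unfolding f_U ball_img by (auto simp: B_def intro!: lborelD borel_open)
  have "emeasure lebesgue (f ` S) = emeasure lebesgue (f ` ?U \<union> f ` (S - ?U))"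
    by (subst S_eq) (simp only: image_Un)
  also have "\<dots> = emeasure lebesgue (f ` ?U)"
    using meas(2) null' by (intro emeasure_Un_null_set) (auto simp: negligible_iff_null_sets)
  also have "\<dots> = (\<integral>\<^sup>+i. emeasure lebesgue (f ` B i) \<partial>count_space C)"
    unfolding f_U by (rule emeasure_UN_countable) (auto simp: ball_img C disj'[unfolded ball_img])
  also have "\<dots> = (\<integral>\<^sup>+i. emeasure lebesgue (B i) \<partial>count_space C)"
  proof (rule nn_integral_cong)
    fix i assume "i \<in> space (count_space C)"
    then have "0 < snd i"
      using C(2) by (auto simp: K_def)
    then show "emeasure lebesgue (f ` B i) = emeasure lebesgue (B i)"
      unfolding ball_img by (simp add: B_def emeasure_ball)
  qed
  also have "\<dots> = emeasure lebesgue ?U"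
    by (rule emeasure_UN_countable[symmetric]) (auto simp: B_def C disj[unfolded B_def])
  also have "\<dots> = emeasure lebesgue (?U \<union> (S - ?U))"
    using meas(1) null by (intro emeasure_Un_null_set[symmetric]) (auto simp: negligible_iff_null_sets)
  also have "\<dots> = emeasure lebesgue S"
    using S_eq by simp
  finally show ?thesis .
qed

definition cylinder :: "'a::euclidean_space \<Rightarrow> real \<Rightarrow> real \<Rightarrow> real \<Rightarrow> 'a set" where
  "cylinder \<omega> a b \<rho> = {x. a \<le> x \<bullet> \<omega> \<and> x \<bullet> \<omega> \<le> b \<and> norm (x - (x \<bullet> \<omega>) *\<^sub>R \<omega>) \<le> \<rho>}"

lemma norm_axial_decomposition:
  fixes x \<omega> :: "'a::real_inner"
  assumes "norm \<omega> = 1"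
  shows "(norm x)\<^sup>2 = (x \<bullet> \<omega>)\<^sup>2 + (norm (x - (x \<bullet> \<omega>) *\<^sub>R \<omega>))\<^sup>2"
proof -
  have "\<omega> \<bullet> \<omega> = 1"
    using assms by (simp add: norm_eq_1)
  then show ?thesis
    unfolding power2_norm_eq_inner
    by (simp add: inner_diff_left inner_diff_right inner_commute power2_eq_square)
qed

lemma compact_cylinder:
  assumes "norm \<omega> = 1" "0 \<le> a"
  shows "compact (cylinder \<omega> a b \<rho>)"
proof -
  have "closed (cylinder \<omega> a b \<rho>)"
    unfolding cylinder_def
    by (intro closed_Collect_conj closed_Collect_le continuous_intros)
  moreover have "norm x \<le> sqrt (b\<^sup>2 + \<rho>\<^sup>2)" if "x \<in> cylinder \<omega> a b \<rho>" for x
  proof (rule real_le_rsqrt)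
    have "(x \<bullet> \<omega>)\<^sup>2 \<le> b\<^sup>2" "(norm (x - (x \<bullet> \<omega>) *\<^sub>R \<omega>))\<^sup>2 \<le> \<rho>\<^sup>2"
      using that assms(2) by (auto simp: cylinder_def intro!: power_mono)
    then show "(norm x)\<^sup>2 \<le> b\<^sup>2 + \<rho>\<^sup>2"
      unfolding norm_axial_decomposition[OF assms(1), of x] by simp
  qed
  ultimately show ?thesis
    unfolding compact_eq_bounded_closed bounded_iff by blast
qed

text \<open>A cylinder of any axis contains a rotated box whose sides orthogonal to the axis have length
  \<open>2 * \<rho> / N\<close>: the \<open>l\<^sub>1\<close> norm bounds the Euclidean norm, so such a box stays within distance \<open>\<rho>\<close> of
  the axis.\<close>

lemma measure_cylinder_ge:
  fixes \<omega> :: "real ^ 'n"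
  assumes \<omega>: "norm \<omega> = 1" and ab: "0 \<le> a" "a \<le> b" and \<rho>: "0 \<le> \<rho>"
  shows "(b - a) * (2 * \<rho> / CARD('n)) ^ (CARD('n) - 1) \<le> measure lebesgue (cylinder \<omega> a b \<rho>)"
proof -
  obtain k :: 'n where True by blast
  have "norm (axis k 1 :: real ^ 'n) = 1"
    by simp
  then obtain f :: "real ^ 'n \<Rightarrow> real ^ 'n"
    where f: "orthogonal_transformation f" and f\<omega>: "f (axis k 1) = \<omega>"
    using orthogonal_transformation_exists_1 \<omega> by blast
  have lin: "linear f" and norm_f: "\<And>x. norm (f x) = norm x" and inner_f: "\<And>x y. f x \<bullet> f y = x \<bullet> y"
    using f by (auto simp: orthogonal_transformation_def orthogonal_transformation_norm[OF f])
  define l u :: "real ^ 'n" where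
    "l = (\<chi> i. if i = k then a else - \<rho> / CARD('n))" and
    "u = (\<chi> i. if i = k then b else \<rho> / CARD('n))"
  have sub: "f ` box l u \<subseteq> cylinder \<omega> a b \<rho>"
  proof clarify
    fix y assume "y \<in> box l u"
    then have y: "a \<le> y $ k" "y $ k \<le> b" "\<And>i. i \<noteq> k \<Longrightarrow> \<bar>y $ i\<bar> \<le> \<rho> / CARD('n)"
      unfolding mem_box_cart l_def u_def
      by (force simp: abs_le_iff intro: less_imp_le split: if_splits)+
    have height: "f y \<bullet> \<omega> = y $ k"
      by (simp add: inner_f inner_axis flip: f\<omega>)
    have "norm (f y - (y $ k) *\<^sub>R \<omega>) = norm (f (y - (y $ k) *\<^sub>R axis k 1))"
      by (simp add: linear_diff[OF lin] linear_cmul[OF lin] f\<omega>)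
    also have "\<dots> = norm (y - (y $ k) *\<^sub>R axis k 1)"
      by (rule norm_f)
    also have "\<dots> \<le> (\<Sum>i\<in>UNIV. \<bar>(y - (y $ k) *\<^sub>R axis k 1) $ i\<bar>)"
      by (rule norm_le_l1_cart)
    also have "\<dots> \<le> (\<Sum>i\<in>(UNIV::'n set). \<rho> / CARD('n))"
      by (rule sum_mono) (use y(3) \<rho> in \<open>auto simp: axis_def\<close>)
    also have "\<dots> = \<rho>"
      by simp
    finally show "f y \<in> cylinder \<omega> a b \<rho>"
      using y by (simp add: cylinder_def height)
  qed
  have "\<forall>i. l $ i \<le> u $ i"
    using ab \<rho> by (auto simp: l_def u_def intro: order_trans[of _ 0])
  then have ne: "cbox l u \<noteq> {}"
    by (simp add: box_ne_empty inner_axis Basis_vec_def)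
  have "(b - a) * (2 * \<rho> / CARD('n)) ^ (CARD('n) - 1) = (\<Prod>i\<in>UNIV. u $ i - l $ i)"
    by (subst prod.remove[of _ k]) (auto simp: l_def u_def card_Diff_singleton)
  also have "\<dots> = measure lebesgue (box l u)"
    using content_cbox_cart[OF ne] by (simp add: measure_lborel_box_eq measure_lborel_cbox_eq)
  also have "\<dots> \<le> measure lebesgue (cylinder \<omega> a b \<rho>)"
  proof -
    have C: "cylinder \<omega> a b \<rho> \<in> lmeasurable"
      using compact_cylinder[OF \<omega>] ab by (simp add: lmeasurable_compact)
    have "emeasure lebesgue (box l u) = emeasure lebesgue (f ` box l u)"
      using emeasure_orthogonal_image_open[OF f open_box] ..
    also have "\<dots> \<le> emeasure lebesgue (cylinder \<omega> a b \<rho>)"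
      using sub C by (intro emeasure_mono) auto
    finally show ?thesis
      using C by (simp add: emeasure_eq_measure2 lmeasurable_box)
  qed
  finally show ?thesis .
qed

section \<open>A cylinder inside a truncated funnel\<close>

text \<open>The funnel widens with height, so its part between the heights \<open>s * h / 2\<close> and \<open>s * h\<close> contains
  the cylinder over its section at the lower of these heights; this section has radius \<open>\<rho>\<close>. As
  \<open>1 / \<beta> \<ge> 1\<close>, the radius \<open>\<rho>\<close> is less than \<open>s\<close> times the largest radius \<open>L\<close> of the funnel, which
  keeps the cylinder inside the open ball whose radius is \<open>s\<close> times the diagonal of height and
  largest radius.\<close>

lemma cylinder_subset_funnel:
  fixes \<omega> :: "'a::euclidean_space"
  assumes \<beta>: "0 < \<beta>" "\<beta> \<le> 1" and \<delta>: "0 < \<delta>" and h: "0 < h" and s: "0 < s" "s \<le> 1"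
    and \<omega>: "norm \<omega> = 1"
  defines "L \<equiv> (h / \<delta>) powr (1 / \<beta>)"
  defines "\<rho> \<equiv> L * (s / 2) powr (1 / \<beta>)"
  shows "cylinder \<omega> (s * h / 2) (s * h) \<rho> \<subseteq> beta_funnel \<beta> \<omega> \<delta> h"
    and "cylinder \<omega> (s * h / 2) (s * h) \<rho> \<subseteq> ball 0 (s * sqrt (h\<^sup>2 + L\<^sup>2))"
proof -
  have L: "0 < L" using h \<delta> by (simp add: L_def)
  have \<rho>: "0 < \<rho>" using L s by (simp add: \<rho>_def)
  have "\<rho> powr \<beta> = h / \<delta> * (s / 2)"
    using \<beta> \<delta> h s by (simp add: \<rho>_def L_def powr_mult powr_powr)
  then have \<rho>\<beta>: "\<delta> * \<rho> powr \<beta> = s * h / 2"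
    using \<delta> by simp
  show "cylinder \<omega> (s * h / 2) (s * h) \<rho> \<subseteq> beta_funnel \<beta> \<omega> \<delta> h"
  proof
    fix x assume x: "x \<in> cylinder \<omega> (s * h / 2) (s * h) \<rho>"
    then have "norm (x - (x \<bullet> \<omega>) *\<^sub>R \<omega>) powr \<beta> \<le> \<rho> powr \<beta>"
      using \<beta> by (intro powr_mono2) (auto simp: cylinder_def)
    then have "\<delta> * norm (x - (x \<bullet> \<omega>) *\<^sub>R \<omega>) powr \<beta> \<le> s * h / 2"
      unfolding \<rho>\<beta>[symmetric] using \<delta> by simp
    moreover have "s * h \<le> h"
      using s h by simp
    ultimately show "x \<in> beta_funnel \<beta> \<omega> \<delta> h"
      using x unfolding beta_funnel_def cylinder_def mem_Collect_eq by linarith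
  qed
  have "(s / 2) powr (1 / \<beta>) \<le> (s / 2) powr 1"
    using s \<beta> by (intro powr_mono') (auto simp: field_simps)
  then have "(s / 2) powr (1 / \<beta>) < s"
    using s by simp
  then have \<rho>_less: "\<rho> < s * L"
    using L by (simp add: \<rho>_def mult.commute)
  show "cylinder \<omega> (s * h / 2) (s * h) \<rho> \<subseteq> ball 0 (s * sqrt (h\<^sup>2 + L\<^sup>2))"
  proof
    fix x assume x: "x \<in> cylinder \<omega> (s * h / 2) (s * h) \<rho>"
    have "0 \<le> s * h / 2"
      using s h by simp
    then have "(x \<bullet> \<omega>)\<^sup>2 \<le> (s * h)\<^sup>2"
      using x by (intro power_mono) (auto simp: cylinder_def)
    moreover have "(norm (x - (x \<bullet> \<omega>) *\<^sub>R \<omega>))\<^sup>2 < (s * L)\<^sup>2"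
      using x \<rho>_less by (intro power_strict_mono) (auto simp: cylinder_def)
    ultimately have "(norm x)\<^sup>2 < s\<^sup>2 * (h\<^sup>2 + L\<^sup>2)"
      unfolding norm_axial_decomposition[OF \<omega>, of x] by (simp add: algebra_simps power_mult_distrib)
    then have "norm x < sqrt (s\<^sup>2 * (h\<^sup>2 + L\<^sup>2))"
      by (rule real_less_rsqrt)
    then show "x \<in> ball 0 (s * sqrt (h\<^sup>2 + L\<^sup>2))"
      using s by (simp add: real_sqrt_mult)
  qed
qed

lemma measure_funnel_complement_ge:
  fixes \<Omega> :: "(real ^ 'n) set"
  assumes \<beta>: "0 < \<beta>" "\<beta> \<le> 1" and \<delta>: "0 < \<delta>" and h: "0 < h" and s: "0 < s" "s \<le> 1"
    and \<omega>: "norm \<omega> = 1" and \<Omega>: "open \<Omega>" and ext: "(+) x ` beta_funnel \<beta> \<omega> \<delta> h \<subseteq> - \<Omega>"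
  defines "L \<equiv> (h / \<delta>) powr (1 / \<beta>)"
  shows "s * h / 2 * (2 * (L * (s / 2) powr (1 / \<beta>)) / CARD('n)) ^ (CARD('n) - 1)
           \<le> measure lebesgue (ball x (s * sqrt (h\<^sup>2 + L\<^sup>2)) - \<Omega>)"
proof -
  let ?\<rho> = "L * (s / 2) powr (1 / \<beta>)"
  let ?C = "cylinder \<omega> (s * h / 2) (s * h) ?\<rho>"
  let ?r = "s * sqrt (h\<^sup>2 + L\<^sup>2)"
  note C_sub = cylinder_subset_funnel[OF \<beta> \<delta> h s \<omega>, folded L_def]
  have pos: "0 \<le> s * h / 2" "s * h / 2 \<le> s * h" "0 \<le> ?\<rho>"
    using s h by (auto simp: L_def)
  have C: "?C \<in> lmeasurable"
    using compact_cylinder[OF \<omega> pos(1)] by (rule lmeasurable_compact)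
  have "(+) x ` ?C \<subseteq> (+) x ` ball 0 ?r"
    using C_sub(2) by (rule image_mono)
  then have in_ball: "(+) x ` ?C \<subseteq> ball x ?r"
    by simp
  have "(+) x ` ?C \<subseteq> - \<Omega>"
    using C_sub(1) ext by blast
  have "s * h / 2 * (2 * ?\<rho> / CARD('n)) ^ (CARD('n) - 1) \<le> measure lebesgue ?C"
    using measure_cylinder_ge[OF \<omega> pos] by (simp add: mult.commute)
  also have "\<dots> = measure lebesgue ((+) x ` ?C)"
    by (simp add: measure_translation)
  also have "\<dots> \<le> measure lebesgue (ball x ?r - \<Omega>)"
  proof (rule measure_mono_fmeasurable)
    show "(+) x ` ?C \<subseteq> ball x ?r - \<Omega>"
      using in_ball \<open>(+) x ` ?C \<subseteq> - \<Omega>\<close> by blast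
    show "(+) x ` ?C \<in> sets lebesgue"
      using measurable_translation[OF C] by (rule fmeasurableD)
    show "ball x ?r - \<Omega> \<in> lmeasurable"
      using \<Omega> by (intro fmeasurable_Diff lmeasurable_ball) (auto intro!: lborelD)
  qed
  finally show ?thesis .
qed

section \<open>The density as a function of the aspect ratio\<close>

text \<open>This is where the minimum in the theorem comes from. For large \<open>\<kappa>\<close> the right-hand side
  decays like \<open>1 / \<kappa>\<close>. For \<open>\<kappa> \<le> 1\<close> it is of order \<open>\<kappa> ^ (N - 1)\<close>, which is at least the power with the
  larger exponent \<open>(N - 1) / \<beta>\<close>. The constant \<open>2 ^ N\<close> absorbs the estimate
  \<open>sqrt (1 + \<kappa>\<^sup>2) \<le> 2 * max 1 \<kappa>\<close>.\<close>

lemma min_profile_le: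
  fixes \<kappa> \<beta> :: real and N :: nat
  assumes \<kappa>: "0 < \<kappa>" and \<beta>: "0 < \<beta>" "\<beta> \<le> 1" and N: "0 < N"
  shows "min (\<kappa> powr (real (N - 1) / \<beta>)) (1 / \<kappa>) \<le> 2 ^ N * \<kappa> ^ (N - 1) / sqrt (1 + \<kappa>\<^sup>2) ^ N"
proof (cases "\<kappa> \<le> 1")
  case True
  have "sqrt (1 + \<kappa>\<^sup>2) \<le> 2"
    using True \<kappa> power_le_one[of \<kappa> 2] by (intro real_le_lsqrt) auto
  then have le: "sqrt (1 + \<kappa>\<^sup>2) ^ N \<le> 2 ^ N"
    by (intro power_mono) auto
  have "real (N - 1) * \<beta> \<le> real (N - 1)"
    using \<beta> by (simp add: mult_left_le)
  then have "\<kappa> powr (real (N - 1) / \<beta>) \<le> \<kappa> powr real (N - 1)"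
    using True \<kappa> \<beta> by (intro powr_mono') (auto simp: field_simps)
  also have "\<dots> = \<kappa> ^ (N - 1)"
    using \<kappa> by (simp add: powr_realpow)
  also have "\<dots> \<le> 2 ^ N * \<kappa> ^ (N - 1) / sqrt (1 + \<kappa>\<^sup>2) ^ N"
    using mult_right_mono[OF le, of "\<kappa> ^ (N - 1)"] \<kappa>
    by (simp add: pos_le_divide_eq add_pos_nonneg mult.commute)
  finally show ?thesis by simp
next
  case False
  have "1 + \<kappa>\<^sup>2 \<le> (2 * \<kappa>)\<^sup>2"
  proof -
    have "1 \<le> \<kappa>\<^sup>2"
      using False by (simp add: one_le_power)
    then show ?thesis
      by (simp add: power_mult_distrib)
  qed
  then have "sqrt (1 + \<kappa>\<^sup>2) \<le> 2 * \<kappa>"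
    using \<kappa> by (intro real_le_lsqrt) auto
  then have "sqrt (1 + \<kappa>\<^sup>2) ^ N \<le> (2 * \<kappa>) ^ N"
    by (intro power_mono) auto
  also have "\<dots> = 2 ^ N * \<kappa> ^ (N - 1) * \<kappa>"
    using N by (cases N) (auto simp: power_mult_distrib)
  finally have "1 / \<kappa> \<le> 2 ^ N * \<kappa> ^ (N - 1) / sqrt (1 + \<kappa>\<^sup>2) ^ N"
    using \<kappa> by (simp add: field_simps add_pos_nonneg)
  then show ?thesis by simp
qed

text \<open>The exponent of the weight is chosen exactly so that it compensates the thinning of the
  funnel: at relative scale \<open>s\<close> the cylinder has height of order \<open>s\<close> and radius of order
  \<open>s powr (1 / \<beta>)\<close>, while the volume of the ball is of order \<open>s ^ N\<close>.\<close>

lemma scale_exponents_cancel: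
  fixes s \<beta> :: real and N :: nat
  assumes s: "0 < s" and N: "0 < N"
  shows "(1 / s) powr (real (N - 1) * (1 / \<beta> - 1)) * (s * (s powr (1 / \<beta>)) ^ (N - 1)) = s ^ N"
proof -
  have "(1 / s) powr (real (N - 1) * (1 / \<beta> - 1)) = s powr (- (real (N - 1) * (1 / \<beta> - 1)))"
    using s by (simp add: powr_minus_divide powr_divide)
  moreover have "(s powr (1 / \<beta>)) ^ (N - 1) = s powr (1 / \<beta> * real (N - 1))"
    using s by (simp add: powr_powr flip: powr_realpow)
  moreover have "s powr (- (real (N - 1) * (1 / \<beta> - 1))) * (s powr 1 * s powr (1 / \<beta> * real (N - 1)))
      = s powr real N"
    unfolding powr_add[symmetric] using N by (simp add: algebra_simps of_nat_diff)
  ultimately show ?thesis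
    using s by (simp add: powr_realpow)
qed

text \<open>The largest radius of the funnel in units of its height is
  \<open>(h powr (1 - \<beta>) / \<delta>) powr (1 / \<beta>)\<close>. This aspect ratio, called \<open>\<kappa>\<close> below, is the only parameter
  that survives rescaling.\<close>

lemma funnel_radius_eq:
  fixes h \<delta> \<beta> :: real
  assumes "0 < \<beta>" "0 < \<delta>" "0 < h"
  shows "(h / \<delta>) powr (1 / \<beta>) = (h powr (1 - \<beta>) / \<delta>) powr (1 / \<beta>) * h"
proof -
  have "h / \<delta> = h powr (1 - \<beta>) / \<delta> * h powr \<beta>"
    using assms by (simp flip: powr_add)
  then have "(h / \<delta>) powr (1 / \<beta>) = (h powr (1 - \<beta>) / \<delta> * h powr \<beta>) powr (1 / \<beta>)"
    by (rule arg_cong)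
  also have "\<dots> = (h powr (1 - \<beta>) / \<delta>) powr (1 / \<beta>) * h"
    using assms by (subst powr_mult) (auto simp: powr_powr)
  finally show ?thesis .
qed

text \<open>The volume of the cylinder divided by the volume of the ball: powers of \<open>s\<close> cancel against the
  weight, powers of \<open>h\<close> cancel by homogeneity, and a function of \<open>\<kappa>\<close> alone is left.\<close>

lemma weighted_density_ge:
  fixes \<Omega> :: "(real ^ 'n) set" and \<beta> \<delta> h r :: real
  assumes \<beta>: "0 < \<beta>" "\<beta> \<le> 1" and \<delta>: "0 < \<delta>" and h: "0 < h"
    and \<Omega>: "open \<Omega>" "uniform_exterior_funnel \<beta> h \<delta> \<Omega>" "x \<in> frontier \<Omega>"
  defines "N \<equiv> CARD('n)"
  defines "\<kappa> \<equiv> (h powr (1 - \<beta>) / \<delta>) powr (1 / \<beta>)"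
  defines "r\<^sub>0 \<equiv> sqrt (h\<^sup>2 + (\<kappa> * h)\<^sup>2)"
  assumes r: "0 < r" "r \<le> r\<^sub>0"
  shows "(2 / (N * 2 powr (1 / \<beta>))) ^ (N - 1) / (2 * unit_ball_vol N)
             * (\<kappa> ^ (N - 1) / sqrt (1 + \<kappa>\<^sup>2) ^ N)
           \<le> (r\<^sub>0 / r) powr (real (N - 1) * (1 / \<beta> - 1)) *
              (measure lebesgue (ball x r - \<Omega>) / measure lebesgue (ball x r))"
proof -
  define s where "s = r / r\<^sub>0"
  have \<kappa>: "0 < \<kappa>" using h \<delta> by (simp add: \<kappa>_def)
  have r\<^sub>0: "0 < r\<^sub>0" using r by linarith
  have s: "0 < s" "s \<le> 1" and r_eq: "r = s * r\<^sub>0"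
    using r r\<^sub>0 by (auto simp: s_def)
  have N: "0 < N" by (simp add: N_def)
  have L: "(h / \<delta>) powr (1 / \<beta>) = \<kappa> * h"
    unfolding \<kappa>_def using funnel_radius_eq[OF \<beta>(1) \<delta> h] .
  have r\<^sub>0_eq: "r\<^sub>0 = h * sqrt (1 + \<kappa>\<^sup>2)"
  proof -
    have "h\<^sup>2 + (\<kappa> * h)\<^sup>2 = h\<^sup>2 * (1 + \<kappa>\<^sup>2)"
      by (simp add: algebra_simps power_mult_distrib)
    then show ?thesis
      unfolding r\<^sub>0_def using h by (simp add: real_sqrt_mult)
  qed
  obtain \<omega> where \<omega>: "norm \<omega> = 1" "(+) x ` beta_funnel \<beta> \<omega> \<delta> h \<subseteq> - \<Omega>"
    using \<Omega>(2,3) unfolding uniform_exterior_funnel_def by (auto simp: dist_norm)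
  have vol: "s * h / 2 * (2 * (\<kappa> * h * (s / 2) powr (1 / \<beta>)) / N) ^ (N - 1)
      \<le> measure lebesgue (ball x r - \<Omega>)"
    using measure_funnel_complement_ge[OF \<beta> \<delta> h s \<omega>(1) \<Omega>(1) \<omega>(2)]
    unfolding L N_def[symmetric] r\<^sub>0_def[symmetric] r_eq .
  have ball_vol: "measure lebesgue (ball x r) = unit_ball_vol N * s ^ N * h ^ N * sqrt (1 + \<kappa>\<^sup>2) ^ N"
    using content_ball[of r x] r by (simp add: N_def r_eq r\<^sub>0_eq power_mult_distrib)
  let ?w = "(1 / s) powr (real (N - 1) * (1 / \<beta> - 1))"
  let ?S = "s * (s powr (1 / \<beta>)) ^ (N - 1)"
  let ?c = "(2 / (N * 2 powr (1 / \<beta>))) ^ (N - 1)"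
  have cyl: "s * h / 2 * (2 * (\<kappa> * h * (s / 2) powr (1 / \<beta>)) / N) ^ (N - 1)
      = ?S * ?c * \<kappa> ^ (N - 1) * h ^ N / 2"
  proof -
    have "2 * (\<kappa> * h * (s / 2) powr (1 / \<beta>)) / N
        = (2 / (N * 2 powr (1 / \<beta>))) * \<kappa> * h * s powr (1 / \<beta>)"
      using s by (simp add: powr_divide mult_ac)
    moreover have "h ^ N = h * h ^ (N - 1)"
      using N by (cases N) auto
    ultimately show ?thesis
      by (simp only: power_mult_distrib) (simp add: algebra_simps)
  qed
  have "?c / (2 * unit_ball_vol N) * (\<kappa> ^ (N - 1) / sqrt (1 + \<kappa>\<^sup>2) ^ N)
      = s ^ N * (?c * \<kappa> ^ (N - 1) * h ^ N / 2) / measure lebesgue (ball x r)"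
    unfolding ball_vol using s h by simp
  also have "\<dots> = ?w * (?S * ?c * \<kappa> ^ (N - 1) * h ^ N / 2 / measure lebesgue (ball x r))"
    unfolding scale_exponents_cancel[OF s(1) N, of \<beta>, symmetric] by simp
  also have "\<dots> \<le> ?w * (measure lebesgue (ball x r - \<Omega>) / measure lebesgue (ball x r))"
    using vol unfolding cyl by (intro mult_left_mono divide_right_mono) auto
  also have "1 / s = r\<^sub>0 / r"
    by (simp add: s_def)
  finally show ?thesis .
qed

theorem lemma5p12:
  fixes \<beta> :: real
  assumes "CARD('n::finite) \<ge> 2" and "0 < \<beta>" and "\<beta> \<le> 1"
  shows "\<exists>c>0. \<forall>(h\<^sub>0::real) (\<delta>::real) (\<Omega> :: (real ^ 'n) set).
           h\<^sub>0 > 0 \<longrightarrow> \<delta> > 0 \<longrightarrow> open \<Omega> \<longrightarrow> \<Omega> \<noteq> UNIV \<longrightarrow>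
           uniform_exterior_funnel \<beta> h\<^sub>0 \<delta> \<Omega> \<longrightarrow>
           (let N = real CARD('n);
                r\<^sub>0 = sqrt (h\<^sub>0\<^sup>2 + (h\<^sub>0 / \<delta>) powr (2 / \<beta>));
                t = (N - 1) * (1 / \<beta> - 1)
            in density_index \<Omega> r\<^sub>0 t \<ge>
                 ereal (c * min ((h\<^sub>0 powr (1 - \<beta>) / \<delta>) powr ((1 / \<beta>) * ((N - 1) / \<beta>)))
                                ((\<delta> / h\<^sub>0 powr (1 - \<beta>)) powr (1 / \<beta>))))"
proof -
  define N where "N = CARD('n)"
  define A where "A = (2 / (N * 2 powr (1 / \<beta>))) ^ (N - 1) / (2 * unit_ball_vol N)"
  have N: "0 < N" "real (N - 1) = real N - 1"
    using assms(1) by (auto simp: N_def of_nat_diff)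
  have A: "0 < A"
    unfolding A_def using N(1) by (intro divide_pos_pos zero_less_power) auto
  have bound: "ereal (A / 2 ^ N * min ((h powr (1 - \<beta>) / \<delta>) powr ((1 / \<beta>) * ((real N - 1) / \<beta>)))
                       ((\<delta> / h powr (1 - \<beta>)) powr (1 / \<beta>)))
      \<le> density_index \<Omega> (sqrt (h\<^sup>2 + (h / \<delta>) powr (2 / \<beta>))) ((real N - 1) * (1 / \<beta> - 1))"
    if h: "h > 0" and \<delta>: "\<delta> > 0" and \<Omega>: "open \<Omega>" "uniform_exterior_funnel \<beta> h \<delta> \<Omega>"
    for h \<delta> and \<Omega> :: "(real ^ 'n) set"
  proof -
    define \<kappa> where "\<kappa> = (h powr (1 - \<beta>) / \<delta>) powr (1 / \<beta>)"
    have \<kappa>: "0 < \<kappa>" using h \<delta> by (simp add: \<kappa>_def)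
    have e1: "(h powr (1 - \<beta>) / \<delta>) powr ((1 / \<beta>) * ((real N - 1) / \<beta>)) = \<kappa> powr (real (N - 1) / \<beta>)"
      unfolding \<kappa>_def powr_powr N(2) ..
    have e2: "(\<delta> / h powr (1 - \<beta>)) powr (1 / \<beta>) = 1 / \<kappa>"
      unfolding \<kappa>_def using h \<delta> by (simp add: powr_divide)
    have e3: "(h / \<delta>) powr (2 / \<beta>) = (\<kappa> * h)\<^sup>2"
    proof -
      have "(h / \<delta>) powr (2 / \<beta>) = ((h / \<delta>) powr (1 / \<beta>)) powr 2"
        by (simp add: powr_powr)
      also have "\<dots> = (\<kappa> * h) powr 2"
        unfolding \<kappa>_def funnel_radius_eq[OF assms(2) \<delta> h] ..
      finally show ?thesis
        using \<kappa> h by simp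
    qed
    have "A / 2 ^ N * min (\<kappa> powr (real (N - 1) / \<beta>)) (1 / \<kappa>)
        \<le> A / 2 ^ N * (2 ^ N * \<kappa> ^ (N - 1) / sqrt (1 + \<kappa>\<^sup>2) ^ N)"
      using min_profile_le[OF \<kappa> assms(2,3) N(1)] A by (intro mult_left_mono) auto
    then have le: "A / 2 ^ N * min (\<kappa> powr (real (N - 1) / \<beta>)) (1 / \<kappa>)
        \<le> A * (\<kappa> ^ (N - 1) / sqrt (1 + \<kappa>\<^sup>2) ^ N)"
      by simp
    show ?thesis
      unfolding e1 e2 e3 density_index_def
    proof (rule Inf_greatest, clarify)
      fix x r assume x: "x \<in> frontier \<Omega>" and r: "0 < r" "r \<le> sqrt (h\<^sup>2 + (\<kappa> * h)\<^sup>2)"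
      note dens = weighted_density_ge[OF assms(2,3) \<delta> h \<Omega> x r(1),
          folded \<kappa>_def N_def, OF r(2), folded A_def, unfolded N(2)]
      show "ereal (A / 2 ^ N * min (\<kappa> powr (real (N - 1) / \<beta>)) (1 / \<kappa>))
          \<le> ereal ((sqrt (h\<^sup>2 + (\<kappa> * h)\<^sup>2) / r) powr ((real N - 1) * (1 / \<beta> - 1)) *
              (measure lebesgue (ball x r - \<Omega>) / measure lebesgue (ball x r)))"
        using order_trans[OF le dens] by simp
    qed
  qed
  show ?thesis
    using A bound unfolding Let_def N_def[symmetric]
    by (intro exI[of _ "A / 2 ^ N"]) auto
qed

end
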